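(* For every even integer $\nu\ge 4$, $\varepsilon(\nu,1)=\nu+2$.
   Context: All graphs are finite, connected and simple. A connected graph $G$ on $\nu$ vertices is $k$-extendable, where $k$ is an integer with $0\le k\le (\nu-2)/2$, if $G$ contains a matching of size $k$ and every matching of size $k$ in $G$ is contained in a perfect matching of $G$. For an integer $k\ge 1$ and an even integer $\nu\ge 2k+2$, $\varepsilon(\nu,k)$ denotes the minimum number of edges of a $k$-extendable non-bipartite graph on $\nu$ vertices. *)

theory Defs
  imports Main
begin

text \<open>A graph is a pair of a vertex set \<^term>\<open>V\<close> and a set \<^term>\<open>E\<close> of unordered edges, each edge
  being the two-element set of its endpoints.\<close>

definition simple_graph :: "'a set \<Rightarrow> 'a set set \<Rightarrow> bool" where
  "simple_graph V E \<longleftrightarrow> finite V \<and> (\<forall>e\<in>E. e \<subseteq> V \<and> card e = 2)"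

definition connected_graph :: "'a set \<Rightarrow> 'a set set \<Rightarrow> bool" where
  "connected_graph V E \<longleftrightarrow>
     simple_graph V E \<and> V \<noteq> {} \<and> (\<forall>u\<in>V. \<forall>v\<in>V. (u, v) \<in> {(x, y). {x, y} \<in> E}\<^sup>*)"

definition bipartite :: "'a set \<Rightarrow> 'a set set \<Rightarrow> bool" where
  "bipartite V E \<longleftrightarrow>
     (\<exists>X Y. X \<union> Y = V \<and> X \<inter> Y = {} \<and> (\<forall>e\<in>E. \<exists>x\<in>X. \<exists>y\<in>Y. e = {x, y}))"

definition matching :: "'a set set \<Rightarrow> 'a set set \<Rightarrow> bool" where
  "matching E M \<longleftrightarrow> M \<subseteq> E \<and> pairwise disjnt M"

definition perfect_matching :: "'a set \<Rightarrow> 'a set set \<Rightarrow> 'a set set \<Rightarrow> bool" where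
  "perfect_matching V E M \<longleftrightarrow> matching E M \<and> \<Union>M = V"

text \<open>The bound \<open>k \<le> (\<nu> - 2) / 2\<close> is written without subtraction, so that it also
  excludes \<open>\<nu> < 2\<close> when \<open>k = 0\<close>.\<close>

definition extendable :: "nat \<Rightarrow> 'a set \<Rightarrow> 'a set set \<Rightarrow> bool" where
  "extendable k V E \<longleftrightarrow>
     connected_graph V E \<and> 2 * k + 2 \<le> card V \<and>
     (\<exists>M. matching E M \<and> card M = k) \<and>
     (\<forall>M. matching E M \<and> card M = k \<longrightarrow> (\<exists>P. perfect_matching V E P \<and> M \<subseteq> P))"

text \<open>Every finite graph is isomorphic to one whose vertices are natural numbers. On \<^typ>\<open>nat\<close>,
  \<^const>\<open>Inf\<close> of a nonempty set is its minimum, and \<^const>\<open>Inf\<close> of the empty set is \<open>0\<close>; a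
  positive value therefore is attained.\<close>

definition min_edges :: "nat \<Rightarrow> nat \<Rightarrow> nat" where
  "min_edges \<nu> k =
     Inf {card E | (V :: nat set) E. card V = \<nu> \<and> extendable k V E \<and> \<not> bipartite V E}"

end

theory Submission
  imports Defs
begin

text \<open>Lower bound: over \<open>GF(2)\<close>, send an edge set to the set of its odd-degree vertices together with
  the parity of its size. On a connected non-bipartite graph with \<open>\<nu>\<close> vertices and \<open>m\<close> edges this linear
  map has rank \<open>\<nu>\<close>, and all perfect matchings lie in one fibre, so there are at most \<open>2 ^ (m - \<nu>)\<close> of them.
  If every edge lies in one of the \<open>p\<close> perfect matchings, then also \<open>2 * m \<le> p * \<nu>\<close>; for \<open>m \<le> \<nu> + 1\<close>
  these two bounds contradict each other. Upper bound: a Hamiltonian cycle with two crossing chords,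
  that is, \<open>K\<^sub>4\<close> with one edge replaced by a path of odd length.\<close>

section \<open>Degree parities of edge sets\<close>

text \<open>In GF(2) terms this is the boundary of \<open>S\<close>, with \<open>sym_diff\<close> as
  the addition of edge sets.\<close>

definition odd_at :: "'a set set \<Rightarrow> 'a \<Rightarrow> bool" where
  "odd_at S v \<longleftrightarrow> odd (card {e\<in>S. v \<in> e})"

lemma odd_card_sym_diff:
  assumes "finite A" "finite B"
  shows "odd (card (sym_diff A B)) \<longleftrightarrow> odd (card A) \<noteq> odd (card B)"
proof -
  have "card (sym_diff A B) = card (A - B) + card (B - A)"
    using assms by (intro card_Un_disjoint) auto
  moreover have "card A = card (A - B) + card (A \<inter> B)" "card B = card (B - A) + card (A \<inter> B)"
    using assms by (metis card_Diff_subset_Int card_mono finite_Int inf_le1 le_add_diff_inverse2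
        Int_commute)+
  ultimately show ?thesis by auto
qed

lemma odd_at_sym_diff:
  assumes "finite A" "finite B"
  shows "odd_at (sym_diff A B) v \<longleftrightarrow> odd_at A v \<noteq> odd_at B v"
proof -
  have "{e \<in> sym_diff A B. v \<in> e} = sym_diff {e\<in>A. v \<in> e} {e\<in>B. v \<in> e}" by auto
  then show ?thesis using assms by (simp add: odd_at_def odd_card_sym_diff)
qed

lemma odd_at_empty [simp]: "\<not> odd_at {} v"
  by (simp add: odd_at_def)

lemma odd_at_single [simp]: "odd_at {e} v \<longleftrightarrow> v \<in> e"
proof -
  have "{e'\<in>{e}. v \<in> e'} = (if v \<in> e then {e} else {})" by auto
  then show ?thesis by (simp add: odd_at_def)
qed

lemma simple_graph_finite_edges: "simple_graph V E \<Longrightarrow> finite E"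
  unfolding simple_graph_def by (meson finite_Pow_iff finite_subset PowI subsetI)

lemma simple_graph_edge_neq: "simple_graph V E \<Longrightarrow> {x, y} \<in> E \<Longrightarrow> x \<noteq> y"
  unfolding simple_graph_def by fastforce

section \<open>Edge sets with prescribed parities\<close>

text \<open>Add up the edges of a walk modulo 2: the parities cancel at its inner vertices. For
  \<open>u = v\<close> the condition says that all degrees are even.\<close>

lemma edge_path_ends:
  assumes g: "simple_graph V E" and "(u, v) \<in> {(x, y). {x, y} \<in> E}\<^sup>*"
  obtains S where "S \<subseteq> E" "\<And>x. odd_at S x \<longleftrightarrow> (x = u) \<noteq> (x = v)"
proof -
  from assms(2) have "\<exists>S\<subseteq>E. \<forall>x. odd_at S x \<longleftrightarrow> (x = u) \<noteq> (x = v)"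
  proof (induction rule: rtrancl_induct)
    case base
    show ?case by (rule exI[of _ "{}"]) simp
  next
    case (step y z)
    then obtain S where S: "S \<subseteq> E" "\<forall>x. odd_at S x \<longleftrightarrow> (x = u) \<noteq> (x = y)" by blast
    have e: "{y, z} \<in> E" "y \<noteq> z" using step simple_graph_edge_neq[OF g] by auto
    have "finite S" using S simple_graph_finite_edges[OF g] finite_subset by blast
    then have "\<forall>x. odd_at (sym_diff S {{y, z}}) x \<longleftrightarrow> (x = u) \<noteq> (x = z)"
      using S e by (subst odd_at_sym_diff) auto
    moreover have "sym_diff S {{y, z}} \<subseteq> E" using S e by auto
    ultimately show ?case by blast
  qed
  then show ?thesis using that by blast
qed

text \<open>If every edge set with all degrees even had even size, any two edge sets joining
  \<open>u\<close> to \<open>w\<close> would agree in size parity, and this parity would 2-colour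
  the graph.\<close>

lemma odd_even_subgraph:
  assumes c: "connected_graph V E" and nb: "\<not> bipartite V E"
  shows "\<exists>C\<subseteq>E. odd (card C) \<and> (\<forall>x. \<not> odd_at C x)"
proof (rule ccontr)
  assume "\<not> ?thesis"
  then have no: "\<exists>x. odd_at C x" if "C \<subseteq> E" "odd (card C)" for C using that by blast
  have g: "simple_graph V E" using c by (simp add: connected_graph_def)
  have fin: "finite S" if "S \<subseteq> E" for S
    using that simple_graph_finite_edges[OF g] finite_subset by blast
  obtain u where u: "u \<in> V" using c by (auto simp: connected_graph_def)
  \<comment> \<open>\<open>b = True\<close> stands for odd size; \<open>w = u\<close> asks for even
    degree everywhere.\<close>
  define reach where "reach b w \<longleftrightarrow>
    (\<exists>S\<subseteq>E. odd (card S) = b \<and> (\<forall>x. odd_at S x \<longleftrightarrow> (x = u) \<noteq> (x = w)))" for b w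
  have cover: "reach True w \<or> reach False w" if "w \<in> V" for w
  proof -
    have "(u, w) \<in> {(x, y). {x, y} \<in> E}\<^sup>*" using c u that by (auto simp: connected_graph_def)
    then obtain S where "S \<subseteq> E" "\<And>x. odd_at S x \<longleftrightarrow> (x = u) \<noteq> (x = w)"
      using edge_path_ends[OF g] by metis
    then show ?thesis unfolding reach_def by metis
  qed
  have disj: "\<not> (reach True w \<and> reach False w)" for w
  proof
    assume "reach True w \<and> reach False w"
    then obtain S T where S: "S \<subseteq> E" "odd (card S)" "\<forall>x. odd_at S x \<longleftrightarrow> (x = u) \<noteq> (x = w)"
      and T: "T \<subseteq> E" "even (card T)" "\<forall>x. odd_at T x \<longleftrightarrow> (x = u) \<noteq> (x = w)"
      unfolding reach_def by auto
    \<comment> \<open>The sum of \<open>S\<close> and \<open>T\<close> has odd size and no odd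
      degree, which \<open>no\<close> rules out.\<close>
    have "odd (card (sym_diff S T))" "\<forall>x. \<not> odd_at (sym_diff S T) x"
      using S T fin by (simp_all add: odd_card_sym_diff odd_at_sym_diff)
    moreover have "sym_diff S T \<subseteq> E" using S T by auto
    ultimately show False using no by blast
  qed
  \<comment> \<open>Adding \<open>{y, z}\<close> modulo 2 moves the end from \<open>y\<close> to
    \<open>z\<close> and flips the size parity, whether or not the edge was already in
    \<open>S\<close>.\<close>
  have step: "reach (\<not> b) z" if r: "reach b y" and e: "{y, z} \<in> E" for b y z
  proof -
    obtain S where S: "S \<subseteq> E" "odd (card S) = b" "\<forall>x. odd_at S x \<longleftrightarrow> (x = u) \<noteq> (x = y)"
      using r unfolding reach_def by auto
    have "y \<noteq> z" using simple_graph_edge_neq[OF g e] .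
    then have "odd (card (sym_diff S {{y, z}})) = (\<not> b)"
      "\<forall>x. odd_at (sym_diff S {{y, z}}) x \<longleftrightarrow> (x = u) \<noteq> (x = z)"
      using S fin[OF S(1)] by (subst odd_card_sym_diff odd_at_sym_diff; auto)+
    moreover have "sym_diff S {{y, z}} \<subseteq> E" using S e by auto
    ultimately show ?thesis unfolding reach_def by blast
  qed
  have "bipartite V E"
    unfolding bipartite_def
  proof (intro exI conjI ballI)
    show "{w\<in>V. reach True w} \<union> {w\<in>V. reach False w} = V" using cover by auto
    show "{w\<in>V. reach True w} \<inter> {w\<in>V. reach False w} = {}" using disj by auto
    fix e assume e: "e \<in> E"
    then obtain y z where yz: "e = {y, z}" and V: "y \<in> V" "z \<in> V"
      using g unfolding simple_graph_def card_2_iff by fastforce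
    have zy: "e = {z, y}" using yz by auto
    show "\<exists>x\<in>{w\<in>V. reach True w}. \<exists>y\<in>{w\<in>V. reach False w}. e = {x, y}"
      using cover[OF V(1)] step[of True y z] step[of False y z] e yz zy V by auto
  qed
  then show False using nb by simp
qed

text \<open>The vertex \<open>u\<close> is dropped because its degree parity is determined by the other ones.\<close>

lemma prescribed_degree_parity:
  assumes c: "connected_graph V E" and nb: "\<not> bipartite V E" and u: "u \<in> V"
    and A: "A \<subseteq> V - {u}"
  shows "\<exists>S\<subseteq>E. odd (card S) = b \<and> (\<forall>v\<in>V - {u}. odd_at S v \<longleftrightarrow> v \<in> A)"
proof -
  have g: "simple_graph V E" using c by (simp add: connected_graph_def)
  have fin: "finite S" if "S \<subseteq> E" for S
    using that simple_graph_finite_edges[OF g] finite_subset by blast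
  have "finite A" using A g finite_subset unfolding simple_graph_def by blast
  then have "\<exists>S\<subseteq>E. \<forall>v\<in>V - {u}. odd_at S v \<longleftrightarrow> v \<in> A" using A
  proof (induction rule: finite_induct)
    case empty
    show ?case by (rule exI[of _ "{}"]) simp
  next
    case (insert w A)
    then obtain S where S: "S \<subseteq> E" "\<forall>v\<in>V - {u}. odd_at S v \<longleftrightarrow> v \<in> A" by auto
    \<comment> \<open>A walk from \<open>u\<close> to \<open>w\<close> toggles the parity at
      \<open>w\<close>; its effect at \<open>u\<close> is not recorded.\<close>
    have "(u, w) \<in> {(x, y). {x, y} \<in> E}\<^sup>*" using c u insert by (auto simp: connected_graph_def)
    then obtain T where T: "T \<subseteq> E" "\<And>x. odd_at T x \<longleftrightarrow> (x = u) \<noteq> (x = w)"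
      using edge_path_ends[OF g] by metis
    have "\<forall>v\<in>V - {u}. odd_at (sym_diff S T) v \<longleftrightarrow> v \<in> insert w A"
      using S T fin insert.hyps by (auto simp: odd_at_sym_diff)
    moreover have "sym_diff S T \<subseteq> E" using S T by auto
    ultimately show ?case by blast
  qed
  then obtain S where S: "S \<subseteq> E" "\<forall>v\<in>V - {u}. odd_at S v \<longleftrightarrow> v \<in> A" by auto
  \<comment> \<open>Adding the odd-size set \<open>C\<close> flips the size parity and leaves all
    degree parities unchanged.\<close>
  obtain C where C: "C \<subseteq> E" "odd (card C)" "\<And>x. \<not> odd_at C x"
    using odd_even_subgraph[OF c nb] by blast
  have "odd (card (sym_diff S C)) = even (card S)"
    "\<forall>v\<in>V - {u}. odd_at (sym_diff S C) v \<longleftrightarrow> v \<in> A" "sym_diff S C \<subseteq> E"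
    using S C fin by (auto simp: odd_at_sym_diff odd_card_sym_diff)
  then show ?thesis using S by metis
qed

section \<open>Counting perfect matchings\<close>

lemma perfect_matching_odd_at:
  assumes "perfect_matching V E P" "v \<in> V"
  shows "odd_at P v"
proof -
  obtain e where e: "e \<in> P" "v \<in> e" using assms unfolding perfect_matching_def by auto
  then have "{e\<in>P. v \<in> e} = {e}"
    using assms unfolding perfect_matching_def matching_def pairwise_def disjnt_def by blast
  then show ?thesis by (simp add: odd_at_def)
qed

lemma perfect_matching_card:
  assumes g: "simple_graph V E" and P: "perfect_matching V E P"
  shows "2 * card P = card V"
proof -
  have "P \<subseteq> E" "\<Union>P = V" "pairwise disjnt P"
    using P by (auto simp: perfect_matching_def matching_def)
  then have "card V = sum card P"
    using g card_Union_disjoint[of P] unfolding simple_graph_def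
    by (metis finite_subset subsetD)
  also have "\<dots> = (\<Sum>e\<in>P. 2)"
    using g \<open>P \<subseteq> E\<close> by (intro sum.cong) (auto simp: simple_graph_def)
  finally show ?thesis by simp
qed

text \<open>Choose an edge set \<open>rep i\<close> for each of the \<open>2 ^ card V\<close> parity
  patterns \<open>i\<close>. Adding a perfect matching \<open>P\<close> shifts the pattern by an
  amount common to all perfect matchings, so the sum determines \<open>i\<close> and then
  \<open>P\<close>. Hence the pairs \<open>(i, P)\<close> inject into the subsets of
  \<open>E\<close>.\<close>

lemma card_perfect_matchings_le:
  assumes c: "connected_graph V E" and nb: "\<not> bipartite V E"
  shows "2 ^ card V * card {P. perfect_matching V E P} \<le> 2 ^ card E"
proof -
  define PM where "PM = {P. perfect_matching V E P}"
  have g: "simple_graph V E" using c by (simp add: connected_graph_def)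
  have fE: "finite E" using simple_graph_finite_edges[OF g] .
  have fV: "finite V" using g by (simp add: simple_graph_def)
  have fin: "finite S" if "S \<subseteq> E" for S using that fE finite_subset by blast
  obtain u where u: "u \<in> V" using c by (auto simp: connected_graph_def)
  \<comment> \<open>A pattern records which vertices other than \<open>u\<close> have odd degree,
    and whether the size is odd.\<close>
  define I where "I = Pow (V - {u}) \<times> (UNIV :: bool set)"
  have "\<forall>i\<in>I. \<exists>S\<subseteq>E. odd (card S) = snd i \<and> (\<forall>v\<in>V - {u}. odd_at S v \<longleftrightarrow> v \<in> fst i)"
    using prescribed_degree_parity[OF c nb u] by (auto simp: I_def)
  then obtain rep where rep: "\<And>i. i \<in> I \<Longrightarrow> rep i \<subseteq> E"
    "\<And>i. i \<in> I \<Longrightarrow> odd (card (rep i)) = snd i"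
    "\<And>i v. i \<in> I \<Longrightarrow> v \<in> V - {u} \<Longrightarrow> odd_at (rep i) v \<longleftrightarrow> v \<in> fst i"
    by (metis (no_types, lifting))
  have PE: "P \<subseteq> E" if "P \<in> PM" for P
    using that by (auto simp: PM_def perfect_matching_def matching_def)
  have inj: "inj_on (\<lambda>(i, P). sym_diff (rep i) P) (I \<times> PM)"
  proof (rule inj_onI)
    fix x y
    assume x: "x \<in> I \<times> PM" and y: "y \<in> I \<times> PM"
      and xy: "(\<lambda>(i, P). sym_diff (rep i) P) x = (\<lambda>(i, P). sym_diff (rep i) P) y"
    obtain A b P where xe: "x = ((A, b), P)" by (metis surj_pair)
    obtain B d Q where ye: "y = ((B, d), Q)" by (metis surj_pair)
    have iP: "(A, b) \<in> I" "P \<in> PM" and jQ: "(B, d) \<in> I" "Q \<in> PM"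
      and eq: "sym_diff (rep (A, b)) P = sym_diff (rep (B, d)) Q"
      using x y xy by (simp_all add: xe ye)
    have odd1: "odd (card (sym_diff (rep (A, b)) P)) = (b \<noteq> odd (card P))"
      using rep[OF iP(1)] PE iP fin by (simp add: odd_card_sym_diff)
    have odd2: "odd (card (sym_diff (rep (B, d)) Q)) = (d \<noteq> odd (card Q))"
      using rep[OF jQ(1)] PE jQ fin by (simp add: odd_card_sym_diff)
    \<comment> \<open>Equal sizes make the two shifts of the size parity coincide.\<close>
    have "card P = card Q"
      using perfect_matching_card[OF g, of P] perfect_matching_card[OF g, of Q] iP jQ
      by (simp add: PM_def)
    then have "b = d" using odd1 odd2 eq by auto
    moreover have "v \<in> A \<longleftrightarrow> v \<in> B" if v: "v \<in> V - {u}" for v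
    proof -
      \<comment> \<open>Every degree in a perfect matching is 1, so adding one complements the
        pattern on \<open>V - {u}\<close>.\<close>
      have "odd_at (sym_diff (rep (A, b)) P) v = (v \<notin> A)"
        using rep[OF iP(1)] PE iP fin v by (auto simp: odd_at_sym_diff PM_def perfect_matching_odd_at)
      moreover have "odd_at (sym_diff (rep (B, d)) Q) v = (v \<notin> B)"
        using rep[OF jQ(1)] PE jQ fin v by (auto simp: odd_at_sym_diff PM_def perfect_matching_odd_at)
      ultimately show ?thesis using eq by auto
    qed
    ultimately have AB: "(A, b) = (B, d)" using iP jQ unfolding I_def by blast
    then have "P = Q" using eq by auto
    with AB show "x = y" by (simp add: xe ye)
  qed
  have "(\<lambda>(i, P). sym_diff (rep i) P) ` (I \<times> PM) \<subseteq> Pow E"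
    using rep(1) PE by fastforce
  then have "card (I \<times> PM) \<le> card (Pow E)" using inj fE by (intro card_inj_on_le) auto
  moreover have "card I = 2 ^ card V"
  proof -
    \<comment> \<open>Leaving out \<open>u\<close> halves the number of subsets; the size parity
      restores the factor 2.\<close>
    have "card V = Suc (card (V - {u}))" using u fV by (metis card.remove)
    then show ?thesis using fV by (simp add: I_def card_cartesian_product card_Pow)
  qed
  ultimately show ?thesis using fE by (simp add: card_cartesian_product card_Pow PM_def)
qed

section \<open>Lower bound on the number of edges\<close>

text \<open>With \<open>p\<close> perfect matchings, \<open>m\<close> edges and \<open>\<nu>\<close>
  vertices, the bounds \<open>2 ^ \<nu> * p \<le> 2 ^ m\<close> and
  \<open>2 * m \<le> p * \<nu>\<close> are used in turn: \<open>p \<ge> 1\<close> gives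
  \<open>m \<ge> \<nu>\<close>, which excludes \<open>p = 1\<close>; \<open>p \<ge> 2\<close> gives
  \<open>m \<ge> \<nu> + 1\<close>, which excludes \<open>p = 2\<close>; \<open>p \<ge> 3\<close>
  gives \<open>m \<ge> \<nu> + 2\<close>.\<close>

lemma nonbipartite_extendable_card_edges_ge:
  assumes ex: "extendable 1 V E" and nb: "\<not> bipartite V E"
  shows "card V + 2 \<le> card E"
proof -
  define PM where "PM = {P. perfect_matching V E P}"
  have c: "connected_graph V E" using ex by (simp add: extendable_def)
  have g: "simple_graph V E" using c by (simp add: connected_graph_def)
  have fE: "finite E" using simple_graph_finite_edges[OF g] .
  have nV: "4 \<le> card V" using ex by (simp add: extendable_def)
  have "PM \<subseteq> Pow E" by (auto simp: PM_def perfect_matching_def matching_def)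
  then have fPM: "finite PM" using fE finite_subset by blast
  have bound: "2 ^ card V * card PM \<le> 2 ^ card E"
    unfolding PM_def by (rule card_perfect_matchings_le[OF c nb])
  have ne: "card PM \<noteq> 0"
    using ex fPM unfolding extendable_def PM_def by auto
  have cover: "E \<subseteq> \<Union>PM"
  proof
    fix e assume "e \<in> E"
    then have "matching E {e} \<and> card {e} = 1" by (simp add: matching_def)
    then obtain P where "perfect_matching V E P" "{e} \<subseteq> P" using ex unfolding extendable_def by blast
    then show "e \<in> \<Union>PM" by (auto simp: PM_def)
  qed
  \<comment> \<open>Count edges through the matchings covering them, each with half as many edges as
    there are vertices.\<close>
  have "card E \<le> card (\<Union>PM)"
    using cover fPM \<open>PM \<subseteq> Pow E\<close> fE by (intro card_mono) (auto intro: finite_subset)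
  also have "\<dots> \<le> sum card PM" by (rule card_Union_le_sum_card)
  finally have "2 * card E \<le> (\<Sum>P\<in>PM. 2 * card P)" by (simp flip: sum_distrib_left)
  also have "\<dots> = (\<Sum>P\<in>PM. card V)"
    by (intro sum.cong) (auto simp: PM_def perfect_matching_card[OF g])
  finally have deg: "2 * card E \<le> card PM * card V" by simp
  have pow: "(2::nat) ^ card V * k \<le> 2 ^ card E" if "k \<le> card PM" for k
    using mult_left_mono[OF that, of "2 ^ card V"] bound by linarith
  have "(2::nat) ^ card V \<le> 2 ^ card E" using pow[of 1] ne by simp
  then have "card V \<le> card E" by simp
  then have "card PM \<noteq> 1" using deg nV by auto
  then have ge2: "2 \<le> card PM" using ne by linarith
  have "(2::nat) ^ Suc (card V) \<le> 2 ^ card E" using pow[OF ge2] by (simp add: mult.commute)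
  then have "Suc (card V) \<le> card E" by (rule power_le_imp_le_exp[rotated]) simp
  then have "card PM \<noteq> 2" using deg by auto
  then have "(2::nat) ^ card V * 3 \<le> 2 ^ card E" using pow[of 3] ge2 by linarith
  \<comment> \<open>As 3 exceeds 2, the exponent must grow by more than 1.\<close>
  moreover have "(2::nat) ^ Suc (card V) < 2 ^ card V * 3" by simp
  ultimately have "(2::nat) ^ Suc (card V) < 2 ^ card E" by linarith
  then have "Suc (card V) < card E" by (rule power_less_imp_less_exp[rotated]) simp
  then show ?thesis by simp
qed

section \<open>An extremal graph\<close>

text \<open>\<open>{0, n - 1}\<close> closes the cycle, \<open>{0, 2}\<close> and
  \<open>{1, 3}\<close> are the crossing chords; \<open>n = 4\<close> gives the complete graph on
  four vertices.\<close>

definition chorded_cycle :: "nat \<Rightarrow> nat set set" where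
  "chorded_cycle n = (\<lambda>i. {i, Suc i}) ` {..<n - 1} \<union> {{0, n - 1}, {0, 2}, {1, 3}}"

text \<open>Counting with multiplicity gives \<open>(n - 1) + 3\<close>. For even \<open>n\<close>
  the reverse inequality will follow from the lower bound.\<close>

lemma chorded_cycle_card_le: "4 \<le> n \<Longrightarrow> card (chorded_cycle n) \<le> n + 2"
proof -
  assume n: "4 \<le> n"
  have "card (chorded_cycle n) \<le> card ((\<lambda>i. {i, Suc i}) ` {..<n - 1}) + card {{0, n - 1}, {0, 2}, {1, 3}}"
    unfolding chorded_cycle_def by (rule card_Un_le)
  also have "\<dots> \<le> (n - 1) + 3"
    using card_image_le[of "{..<n - 1}" "\<lambda>i. {i, Suc i}"]
    by (intro add_mono) (auto simp: card_insert_if)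
  finally show ?thesis using n by simp
qed

text \<open>The chord \<open>{0, 2}\<close> creates the triangle on 0, 1, 2.\<close>

lemma chorded_cycle_not_bipartite:
  assumes n: "4 \<le> n"
  shows "\<not> bipartite {..<n} (chorded_cycle n)"
proof
  assume "bipartite {..<n} (chorded_cycle n)"
  then obtain X Y where XY: "X \<inter> Y = {}" "\<forall>e\<in>chorded_cycle n. \<exists>x\<in>X. \<exists>y\<in>Y. e = {x, y}"
    unfolding bipartite_def by auto
  have split: "a \<in> X \<and> b \<in> Y \<or> b \<in> X \<and> a \<in> Y" if "{a, b} \<in> chorded_cycle n" for a b
    using XY(2) that by (metis doubleton_eq_iff)
  have "{0, 1} \<in> chorded_cycle n" "{1, 2} \<in> chorded_cycle n" "{0, 2} \<in> chorded_cycle n"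
    using n by (auto simp: chorded_cycle_def image_iff intro: bexI[of _ 0] bexI[of _ 1])
  from this[THEN split] show False using XY(1) by blast
qed

lemma chorded_cycle_connected:
  assumes n: "4 \<le> n"
  shows "connected_graph {..<n} (chorded_cycle n)"
proof -
  let ?R = "{(x, y). {x, y} \<in> chorded_cycle n}"
  have "(0, v) \<in> ?R\<^sup>*" if "v < n" for v using that
  proof (induction v)
    case (Suc v)
    have "(v, Suc v) \<in> ?R" using Suc.prems by (auto simp: chorded_cycle_def)
    then show ?case using Suc by (meson Suc_lessD rtrancl.rtrancl_into_rtrancl)
  qed simp
  moreover have "sym (?R\<^sup>*)" by (intro sym_rtrancl) (auto simp: sym_def insert_commute)
  ultimately have "(u, v) \<in> ?R\<^sup>*" if "u < n" "v < n" for u v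
    using that by (meson rtrancl_trans symD)
  moreover have "simple_graph {..<n} (chorded_cycle n)"
    using n by (auto simp: simple_graph_def chorded_cycle_def card_insert_if)
  moreover have "{..<n} \<noteq> {}" using n by (auto simp: lessThan_empty_iff)
  ultimately show ?thesis by (auto simp: connected_graph_def)
qed

text \<open>Three perfect matchings cover all edges: the two alternating classes of the cycle, and
  one that contains both chords.\<close>

lemma chorded_cycle_edge_in_perfect_matching:
  assumes "even n" "4 \<le> n" and e: "e \<in> chorded_cycle n"
  shows "\<exists>P. perfect_matching {..<n} (chorded_cycle n) P \<and> e \<in> P"
proof -
  obtain m where m: "n = 2 * m" "2 \<le> m" using assms by (auto elim!: evenE)
  define f where "f i = {i, Suc i}" for i :: nat
  \<comment> \<open>\<open>M1\<close> takes the cycle edges at even positions, \<open>M2\<close>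
    those at odd positions including the closing edge, and \<open>M3\<close> replaces the first two
    edges of \<open>M1\<close> by the chords.\<close>
  define M1 where "M1 = (\<lambda>i. f (2 * i)) ` {..<m}"
  define M2 where "M2 = (\<lambda>i. f (2 * i + 1)) ` {..<m - 1} \<union> {{0, n - 1}}"
  define M3 where "M3 = (\<lambda>i. f (2 * i)) ` {2..<m} \<union> {{0, 2}, {1, 3}}"
  have E: "chorded_cycle n = f ` {..<n - 1} \<union> {{0, n - 1}, {0, 2}, {1, 3}}"
    unfolding chorded_cycle_def f_def by simp
  have sub: "M1 \<subseteq> chorded_cycle n" "M2 \<subseteq> chorded_cycle n" "M3 \<subseteq> chorded_cycle n"
    unfolding E M1_def M2_def M3_def using m by auto
  have dis: "pairwise disjnt M1" "pairwise disjnt M2" "pairwise disjnt M3"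
    unfolding pairwise_def disjnt_def M1_def M2_def M3_def using m
    by (auto simp: f_def) presburger+
  have half: "v \<in> f (2 * (v div 2))" for v unfolding f_def by simp presburger
  have "\<Union>M1 = {..<n}"
  proof
    show "\<Union>M1 \<subseteq> {..<n}" unfolding M1_def f_def m by auto
    show "{..<n} \<subseteq> \<Union>M1"
    proof
      fix v assume "v \<in> {..<n}"
      then have "v div 2 \<in> {..<m}" using m by auto
      then show "v \<in> \<Union>M1" unfolding M1_def using half[of v] by blast
    qed
  qed
  moreover have "\<Union>M2 = {..<n}"
  proof
    show "\<Union>M2 \<subseteq> {..<n}" unfolding M2_def f_def using m by auto
    show "{..<n} \<subseteq> \<Union>M2"
    proof
      fix v assume v: "v \<in> {..<n}"
      show "v \<in> \<Union>M2"
      proof (cases "v = 0 \<or> v = n - 1")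
        case True then show ?thesis by (auto simp: M2_def)
      next
        case False
        \<comment> \<open>The closing edge matches 0 with \<open>n - 1\<close>, so the others pair
          up as 1 with 2, 3 with 4, and so on; \<open>v \<noteq> 0\<close> makes the truncated
          subtraction exact.\<close>
        then have "Suc (v - 1) = v" "(v - 1) div 2 < m - 1"
          using v m by auto
        then have "v \<in> f (2 * ((v - 1) div 2) + 1)"
          unfolding f_def by simp presburger
        with \<open>(v - 1) div 2 < m - 1\<close> show ?thesis unfolding M2_def by blast
      qed
    qed
  qed
  moreover have "\<Union>M3 = {..<n}"
  proof
    show "\<Union>M3 \<subseteq> {..<n}" unfolding M3_def f_def using m by auto
    show "{..<n} \<subseteq> \<Union>M3"
    proof
      fix v assume v: "v \<in> {..<n}"
      show "v \<in> \<Union>M3"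
      \<comment> \<open>The chords cover 0 to 3; the vertices from 4 on are paired as in
        \<open>M1\<close>.\<close>
      proof (cases "v < 4")
        case True
        then have "v = 0 \<or> v = 1 \<or> v = 2 \<or> v = 3" by linarith
        then show ?thesis by (auto simp: M3_def)
      next
        case False
        then have "v div 2 \<in> {2..<m}" using v m by auto
        then show ?thesis unfolding M3_def using half[of v] by blast
      qed
    qed
  qed
  ultimately have "perfect_matching {..<n} (chorded_cycle n) M"
    if "M \<in> {M1, M2, M3}" for M
    using that sub dis unfolding perfect_matching_def matching_def by auto
  moreover have "e \<in> M1 \<union> M2 \<union> M3"
  proof -
    consider i where "i < n - 1" "e = f i" | "e = {0, n - 1}" | "e = {0, 2}" | "e = {1, 3}"
      using e unfolding E by auto
    then show ?thesis
    proof cases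
      case (1 i)
      show ?thesis
      \<comment> \<open>Positions lie below \<open>n - 1 = 2 * m - 1\<close>, so an odd one is
        \<open>2 * j + 1\<close> with \<open>j < m - 1\<close>, as \<open>M2\<close>
        requires.\<close>
      proof (cases "even i")
        case True
        then obtain j where "i = 2 * j" by (rule evenE)
        then show ?thesis using 1 m by (auto simp: M1_def)
      next
        case False
        then obtain j where "i = 2 * j + 1" by (rule oddE)
        then show ?thesis using 1 m by (auto simp: M2_def)
      qed
    qed (auto simp: M2_def M3_def)
  qed
  ultimately show ?thesis by blast
qed

lemma chorded_cycle_extendable:
  assumes "even n" "4 \<le> n"
  shows "extendable 1 {..<n} (chorded_cycle n)"
  unfolding extendable_def
proof (intro conjI allI impI)
  show "connected_graph {..<n} (chorded_cycle n)" using assms chorded_cycle_connected by simp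
  show "2 * 1 + 2 \<le> card {..<n}" using assms by simp
  show "\<exists>M. matching (chorded_cycle n) M \<and> card M = 1"
    by (rule exI[of _ "{{0, 2}}"]) (simp add: matching_def chorded_cycle_def)
  fix M assume M: "matching (chorded_cycle n) M \<and> card M = 1"
  then obtain e where "M = {e}" by (auto simp: card_1_singleton_iff)
  then show "\<exists>P. perfect_matching {..<n} (chorded_cycle n) P \<and> M \<subseteq> P"
    using chorded_cycle_edge_in_perfect_matching[OF assms, of e] M by (auto simp: matching_def)
qed

theorem theorem3p1:
  fixes \<nu> :: nat
  assumes "even \<nu>" and "\<nu> \<ge> 4"
  shows "min_edges \<nu> 1 = \<nu> + 2"
proof -
  let ?S = "{card E | (V :: nat set) E. card V = \<nu> \<and> extendable 1 V E \<and> \<not> bipartite V E}"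
  have lower: "\<nu> + 2 \<le> k" if "k \<in> ?S" for k
    using that nonbipartite_extendable_card_edges_ge by auto
  have mem: "card (chorded_cycle \<nu>) \<in> ?S"
    using chorded_cycle_extendable[OF assms] chorded_cycle_not_bipartite[OF assms(2)]
    by (auto intro!: exI[of _ "{..<\<nu>}"] exI[of _ "chorded_cycle \<nu>"])
  \<comment> \<open>Membership in \<open>?S\<close> makes \<open>lower\<close> supply the missing
    inequality, so the size of the example is exact.\<close>
  then have "card (chorded_cycle \<nu>) = \<nu> + 2"
    using lower chorded_cycle_card_le[OF assms(2)] by (meson le_antisym)
  then show ?thesis
    unfolding min_edges_def using mem lower by (intro cInf_eq_minimum) auto
qed

end
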